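(* Let $n\ge1$ and define $\varepsilon_n>0$ by $(1+\varepsilon_n)^2 = 1+8190\,e^{-n/10}$. For every $f(t)=\sum_{j=1}^na_je^{i\lambda_jt}$ with $a_j\in\mathbb{C}$ and real $\lambda_1<\cdots<\lambda_n$, $$\|f'\|_{[0,1]} \le 27(1+\varepsilon_n)\,n^{3/2}\left(\sum_{k=1}^n\left(2\left(\frac{\lambda_k}{9n}\right)^2+8(k-1)^2\right)\right)^{1/2}\|f\|_{L_2[0,1]}.$$
   Context: $\|g\|_{[0,1]}:=\sup_{t\in[0,1]}|g(t)|$; $\|f\|_{L_2[0,1]}=(\int_0^1|f|^2)^{1/2}$. *)

theory Defs
  imports "HOL-Analysis.Analysis"
begin

definition exp_sum :: "nat \<Rightarrow> (nat \<Rightarrow> complex) \<Rightarrow> (nat \<Rightarrow> real) \<Rightarrow> real \<Rightarrow> complex" where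
  "exp_sum n a lam t = (\<Sum>j=1..n. a j * exp (\<i> * complex_of_real (lam j * t)))"

definition sup_norm01 :: "(real \<Rightarrow> complex) \<Rightarrow> real" where
  "sup_norm01 g = (SUP t\<in>{0..1}. cmod (g t))"

definition L2_norm01 :: "(real \<Rightarrow> complex) \<Rightarrow> real" where
  "L2_norm01 g = sqrt (integral {0..1} (\<lambda>t. (cmod (g t))\<^sup>2))"

definition eps_n :: "nat \<Rightarrow> real" where
  "eps_n n = sqrt (1 + 8190 * exp (- real n / 10)) - 1"

end

(*
On [0,oo) with weight exp(-2bt), an exponential sum f is orthogonalised by removing one
frequency at a time: multiplying the coefficients of f by Blaschke-type factors vanishing at
lam n gives a sum g of n - 1 terms with |f|^2 = |g|^2 + |f(0) - g(0)|^2 / (2b) in the weighted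
norm. In the resulting orthogonal coordinates d_k, f'(0) is the sum of
(i lam k - 2b(n - k)) d_k, so Cauchy-Schwarz bounds f'(0) by the weighted norm; b = 9n gives the
constants of the theorem.

The part of the weighted norm beyond [0,1/2] is negligible by Turan's method: truncating the
power series of 1 / prod (1 - w_j X) at degree n expresses f(t) through f(t - k delta),
n < k <= 2n, with coefficients of total size at most 8^n. Hence continuing f by 1/4 costs a
factor 64^n in energy, which the weight exp(-18nt) beats.

Every t in [0,1] is an endpoint of an interval of length 1/2 inside [0,1], so translation and
reflection reduce the estimate at t to the one at 0.
*)
theory Submission
  imports Defs
begin

unbundle no vec_syntax and fps_syntax

subsection \<open>Derivative at 0 and the weighted norm\<close>

lemma exp_sum_Suc: "exp_sum (Suc n) a lam t = exp_sum n a lam t + a (Suc n) * exp (\<i> * complex_of_real (lam (Suc n) * t))"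
  by (simp add: exp_sum_def)

lemma exp_sum_has_vector_derivative:
  "(exp_sum n a lam has_vector_derivative exp_sum n (\<lambda>j. \<i> * lam j * a j) lam t) (at t within S)"
proof -
  have *: "((\<lambda>t. a j * exp (\<i> * complex_of_real (lam j * t))) has_vector_derivative
     (\<i> * lam j * a j) * exp (\<i> * complex_of_real (lam j * t))) (at t within S)" for j
  proof -
    have "((\<lambda>z. a j * exp (\<i> * lam j * z)) has_field_derivative
        (\<i> * lam j * a j) * exp (\<i> * lam j * t)) (at (complex_of_real t))"
      by (auto intro!: derivative_eq_intros)
    from has_vector_derivative_real_field[OF this, of S] show ?thesis
      by (simp add: mult.assoc)
  qed
  have "((\<lambda>t. \<Sum>j=1..n. a j * exp (\<i> * complex_of_real (lam j * t))) has_vector_derivative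
     (\<Sum>j=1..n. (\<i> * lam j * a j) * exp (\<i> * complex_of_real (lam j * t)))) (at t within S)"
    by (intro has_vector_derivative_sum *)
  then show ?thesis unfolding exp_sum_def .
qed

lemma continuous_on_exp_sum [continuous_intros]: "continuous_on S (exp_sum n a lam)"
  unfolding exp_sum_def by (intro continuous_intros)

lemma norm_exp_sum_le: "cmod (exp_sum n a lam t) \<le> (\<Sum>j=1..n. cmod (a j))"
proof -
  have "cmod (exp_sum n a lam t) \<le> (\<Sum>j=1..n. cmod (a j * exp (\<i> * complex_of_real (lam j * t))))"
    unfolding exp_sum_def by (rule norm_sum)
  then show ?thesis by (simp add: norm_mult)
qed

text \<open>\<open>D\<close> satisfies \<open>D' = \<i> lam n D - 2 b g\<close>, which makes the derivative of
  \<open>exp (- 2 b t) |D|\<^sup>2\<close> equal to \<open>- 2 b exp (- 2 b t) (|g + D|\<^sup>2 - |g|\<^sup>2)\<close>.\<close>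
lemma exp_sum_peel:
  fixes b T :: real and n :: nat and a :: "nat \<Rightarrow> complex" and lam :: "nat \<Rightarrow> real"
    and g D :: "real \<Rightarrow> complex"
  assumes "b > 0" "T \<ge> 0"
  defines "r \<equiv> \<lambda>j. \<i> * (lam j - lam n) / (\<i> * (lam j - lam n) - 2 * b)"
  defines "g \<equiv> exp_sum n (\<lambda>j. a j * r j) lam" and "D \<equiv> exp_sum n (\<lambda>j. a j * (1 - r j)) lam"
  shows "exp_sum n a lam t = g t + D t"
    and "exp_sum n (\<lambda>j. \<i> * lam j * a j) lam t =
      exp_sum n (\<lambda>j. \<i> * lam j * (a j * r j)) lam t + \<i> * lam n * D t - 2 * b * g t"
    and "2 * b * integral {0..T} (\<lambda>t. exp (- 2 * b * t) * (cmod (exp_sum n a lam t))\<^sup>2)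
      = 2 * b * integral {0..T} (\<lambda>t. exp (- 2 * b * t) * (cmod (g t))\<^sup>2)
        + ((cmod (D 0))\<^sup>2 - exp (- 2 * b * T) * (cmod (D T))\<^sup>2)"
proof -
  show fgD: "exp_sum n a lam t = g t + D t" for t
    by (simp add: g_def D_def exp_sum_def flip: sum.distrib) (simp add: algebra_simps)
  have nz: "\<i> * (lam j - lam n) - 2 * b \<noteq> 0" for j
    using assms by (auto simp: complex_eq_iff)
  \<comment> \<open>This is the defining relation of \<open>r j\<close> with its denominator
    cleared, multiplied by \<open>a j\<close> and rearranged. Summed against the exponentials it
    gives \<open>D1\<close>.\<close>
  have r: "\<i> * lam j * a j = \<i> * lam j * (a j * r j) + \<i> * lam n * (a j * (1 - r j)) - 2 * b * (a j * r j)" for j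
  proof -
    have "r j * (\<i> * (lam j - lam n) - 2 * b) = \<i> * (lam j - lam n)"
      unfolding r_def using nz[of j] by (rule nonzero_eq_divide_eq[THEN iffD1, OF _ refl])
    then have "a j * (r j * (\<i> * (lam j - lam n) - 2 * b)) = a j * (\<i> * (lam j - lam n))"
      by (rule arg_cong)
    then show ?thesis
      by (simp add: algebra_simps)
  qed
  show D1: "exp_sum n (\<lambda>j. \<i> * lam j * a j) lam t =
      exp_sum n (\<lambda>j. \<i> * lam j * (a j * r j)) lam t + \<i> * lam n * D t - 2 * b * g t" for t
    unfolding exp_sum_def D_def g_def sum_distrib_left sum.distrib[symmetric] sum_subtractf[symmetric]
    by (rule sum.cong[OF refl], subst r) (simp add: algebra_simps)
  \<comment> \<open>Subtracting the differentiated \<open>g\<close> from both sides of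
    \<open>D1\<close> identifies this expression as the derivative of \<open>D\<close>.\<close>
  define D' where "D' t = \<i> * lam n * D t - 2 * b * g t" for t
  have DD: "exp_sum n (\<lambda>j. \<i> * lam j * (a j * (1 - r j))) lam t = D' t" for t
    using D1[of t] by (simp add: D'_def exp_sum_def sum_subtractf algebra_simps)
  have Dder: "(D has_vector_derivative D' t) (at t within S)" for t S
    using exp_sum_has_vector_derivative[of n _ lam t S] unfolding D_def DD[symmetric] .
  have sq: "((\<lambda>t. exp (- 2 * b * t) * (D t \<bullet> D t)) has_vector_derivative
       (exp (- 2 * b * t) * (2 * (D t \<bullet> D' t)) + - 2 * b * exp (- 2 * b * t) * (D t \<bullet> D t))) (at t within S)" for t S
    using Dder[of t S] unfolding has_vector_derivative_def
    by (auto intro!: derivative_eq_intros simp: algebra_simps inner_commute)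
  \<comment> \<open>The part \<open>\<i> * lam n * D t\<close> of \<open>D'\<close> is orthogonal to
    \<open>D t\<close> in the real inner product, so \<open>lam n\<close> disappears. What remains,
    -4b D.g - 2b D.D, is -2b times |g + D|^2 - |g|^2.\<close>
  have eq: "exp (- 2 * b * t) * (2 * (D t \<bullet> D' t)) + - 2 * b * exp (- 2 * b * t) * (D t \<bullet> D t)
      = - 2 * b * (exp (- 2 * b * t) * (cmod (exp_sum n a lam t))\<^sup>2 - exp (- 2 * b * t) * (cmod (g t))\<^sup>2)" for t
    unfolding fgD D'_def cmod_power2 inner_complex_def
    by (simp add: algebra_simps power2_eq_square)
  have "((\<lambda>t. - 2 * b * (exp (- 2 * b * t) * (cmod (exp_sum n a lam t))\<^sup>2 - exp (- 2 * b * t) * (cmod (g t))\<^sup>2))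
      has_integral (exp (- 2 * b * T) * (D T \<bullet> D T) - exp (- 2 * b * 0) * (D 0 \<bullet> D 0))) {0..T}"
    using fundamental_theorem_of_calculus[OF assms(2) sq] unfolding eq .
  then have "integral {0..T} (\<lambda>t. - 2 * b * (exp (- 2 * b * t) * (cmod (exp_sum n a lam t))\<^sup>2 - exp (- 2 * b * t) * (cmod (g t))\<^sup>2))
      = exp (- 2 * b * T) * (D T \<bullet> D T) - exp (- 2 * b * 0) * (D 0 \<bullet> D 0)"
    by (rule integral_unique)
  moreover have "integral {0..T} (\<lambda>t. - 2 * b * (exp (- 2 * b * t) * (cmod (exp_sum n a lam t))\<^sup>2 - exp (- 2 * b * t) * (cmod (g t))\<^sup>2))
    = - 2 * b * (integral {0..T} (\<lambda>t. exp (- 2 * b * t) * (cmod (exp_sum n a lam t))\<^sup>2)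
       - integral {0..T} (\<lambda>t. exp (- 2 * b * t) * (cmod (g t))\<^sup>2))"
    unfolding g_def integral_mult_right
    by (subst integral_diff) (auto intro!: integrable_continuous_interval continuous_intros)
  ultimately show "2 * b * integral {0..T} (\<lambda>t. exp (- 2 * b * t) * (cmod (exp_sum n a lam t))\<^sup>2)
      = 2 * b * integral {0..T} (\<lambda>t. exp (- 2 * b * t) * (cmod (g t))\<^sup>2)
        + ((cmod (D 0))\<^sup>2 - exp (- 2 * b * T) * (cmod (D T))\<^sup>2)"
    by (simp add: dot_square_norm algebra_simps)
qed

text \<open>Here \<open>d k\<close> is the value at 0 of the part \<open>D\<close> split off when
  \<open>lam k\<close> is removed. Each later removal subtracts 2b times the sum of all earlier
  coordinates from the derivative, so \<open>d k\<close> collects this n - k times. Working with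
  finite \<open>T\<close> and a constant \<open>C\<close> chosen before \<open>T\<close> avoids
  improper integrals.\<close>

lemma exp_sum_decomposition:
  fixes b :: real
  assumes "b > 0"
  shows "\<exists>d C. exp_sum n a lam 0 = (\<Sum>k=1..n. d k) \<and>
    exp_sum n (\<lambda>j. \<i> * lam j * a j) lam 0 = (\<Sum>k=1..n. (\<i> * lam k - 2 * b * real (n - k)) * d k) \<and>
    (\<forall>T\<ge>0. (\<Sum>k=1..n. (cmod (d k))\<^sup>2) \<le>
      2 * b * integral {0..T} (\<lambda>t. exp (- 2 * b * t) * (cmod (exp_sum n a lam t))\<^sup>2) + C * exp (- 2 * b * T))"
proof (induction n arbitrary: a)
  case 0
  show ?case by (auto simp: exp_sum_def intro!: exI[of _ 0])
next
  case (Suc n)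
  define r where "r j = \<i> * (lam j - lam (Suc n)) / (\<i> * (lam j - lam (Suc n)) - 2 * b)" for j
  define D where "D = exp_sum (Suc n) (\<lambda>j. a j * (1 - r j)) lam"
  \<comment> \<open>\<open>r (Suc n)\<close> is 0, so the last frequency drops out and the induction
    hypothesis applies to the rest.\<close>
  have drop: "exp_sum (Suc n) (\<lambda>j. a j * r j) lam = exp_sum n (\<lambda>j. a j * r j) lam"
    "exp_sum (Suc n) (\<lambda>j. \<i> * lam j * (a j * r j)) lam = exp_sum n (\<lambda>j. \<i> * lam j * (a j * r j)) lam"
    by (auto simp: exp_sum_Suc r_def)
  note peel = exp_sum_peel[OF assms, where n = "Suc n" and lam = lam and a = a,
      folded r_def, unfolded drop, folded D_def]
  obtain d C where d:
    "exp_sum n (\<lambda>j. a j * r j) lam 0 = (\<Sum>k=1..n. d k)"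
    "exp_sum n (\<lambda>j. \<i> * lam j * (a j * r j)) lam 0 = (\<Sum>k=1..n. (\<i> * lam k - 2 * b * real (n - k)) * d k)"
    "\<And>T. T \<ge> 0 \<Longrightarrow> (\<Sum>k=1..n. (cmod (d k))\<^sup>2) \<le>
      2 * b * integral {0..T} (\<lambda>t. exp (- 2 * b * t) * (cmod (exp_sum n (\<lambda>j. a j * r j) lam t))\<^sup>2) + C * exp (- 2 * b * T)"
    using Suc.IH[of "\<lambda>j. a j * r j"] by blast
  define d' where "d' = d(Suc n := D 0)"
  \<comment> \<open>The sum of the coefficient moduli bounds \<open>D\<close> at every
    \<open>T\<close>, which makes the new error constant \<open>C + K\<close> independent of
    \<open>T\<close>.\<close>
  define K where "K = (\<Sum>j=1..Suc n. cmod (a j * (1 - r j)))\<^sup>2"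
  have K: "(cmod (D T))\<^sup>2 \<le> K" for T
    unfolding K_def D_def by (intro power_mono norm_exp_sum_le norm_ge_zero)
  have d'sum: "(\<Sum>k=1..n. h k (d' k)) = (\<Sum>k=1..n. h k (d k))" for h :: "nat \<Rightarrow> complex \<Rightarrow> 'b::comm_monoid_add"
    by (rule sum.cong) (auto simp: d'_def)
  have 1: "exp_sum (Suc n) a lam 0 = (\<Sum>k=1..Suc n. d' k)"
    using peel(1)[of 0 0] d(1) d'sum[of "\<lambda>k x. x"] by (simp add: d'_def)
  have "(\<Sum>k=1..n. (\<i> * lam k - 2 * b * real (Suc n - k)) * d k)
     = (\<Sum>k=1..n. (\<i> * lam k - 2 * b * real (n - k)) * d k - 2 * b * d k)"
    by (rule sum.cong) (auto simp: Suc_diff_le algebra_simps)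
  then have 2: "exp_sum (Suc n) (\<lambda>j. \<i> * lam j * a j) lam 0 = (\<Sum>k=1..Suc n. (\<i> * lam k - 2 * b * real (Suc n - k)) * d' k)"
    using peel(2)[of 0 0] d(1,2) d'sum[of "\<lambda>k x. (\<i> * lam k - 2 * b * real (Suc n - k)) * x"]
    by (simp add: d'_def sum_subtractf sum_distrib_left)
  have 3: "(\<Sum>k=1..Suc n. (cmod (d' k))\<^sup>2) \<le>
      2 * b * integral {0..T} (\<lambda>t. exp (- 2 * b * t) * (cmod (exp_sum (Suc n) a lam t))\<^sup>2) + (C + K) * exp (- 2 * b * T)"
    if "T \<ge> 0" for T
  proof -
    have "exp (- 2 * b * T) * (cmod (D T))\<^sup>2 \<le> exp (- 2 * b * T) * K"
      using K by (intro mult_left_mono) auto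
    moreover have "(\<Sum>k=1..Suc n. (cmod (d' k))\<^sup>2) = (\<Sum>k=1..n. (cmod (d k))\<^sup>2) + (cmod (D 0))\<^sup>2"
      using d'sum[of "\<lambda>k x. (cmod x)\<^sup>2"] by (simp add: d'_def)
    moreover have "(C + K) * exp (- 2 * b * T) = C * exp (- 2 * b * T) + exp (- 2 * b * T) * K"
      by (simp add: algebra_simps)
    ultimately show ?thesis
      using peel(3)[OF that] d(3)[OF that] by linarith
  qed
  show ?case using 1 2 3 by blast
qed

lemma exp_sum_deriv_0_bound:
  fixes b M :: real
  assumes "b > 0"
    and M: "\<And>N. integral {0..(real N + 2) / 4} (\<lambda>t. exp (- 2 * b * t) * (cmod (exp_sum n a lam t))\<^sup>2) \<le> M"
  shows "(cmod (exp_sum n (\<lambda>j. \<i> * lam j * a j) lam 0))\<^sup>2 \<le>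
    b ^ 3 * (\<Sum>k=1..n. 2 * (lam k / b)\<^sup>2 + 8 * (real k - 1)\<^sup>2) * M"
proof -
  obtain d C where d:
    "exp_sum n (\<lambda>j. \<i> * lam j * a j) lam 0 = (\<Sum>k=1..n. (\<i> * lam k - 2 * b * real (n - k)) * d k)"
    "\<And>T. T \<ge> 0 \<Longrightarrow> (\<Sum>k=1..n. (cmod (d k))\<^sup>2) \<le>
      2 * b * integral {0..T} (\<lambda>t. exp (- 2 * b * t) * (cmod (exp_sum n a lam t))\<^sup>2) + C * exp (- 2 * b * T)"
    using exp_sum_decomposition[OF assms(1), of n a lam] by blast
  have "(\<Sum>k=1..n. (cmod (d k))\<^sup>2) \<le> 2 * b * M + C * exp (- 2 * b * ((real N + 2) / 4))" for N
  proof -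
    have "2 * b * integral {0..(real N + 2) / 4} (\<lambda>t. exp (- 2 * b * t) * (cmod (exp_sum n a lam t))\<^sup>2) \<le> 2 * b * M"
      using assms(1) by (intro mult_left_mono M) auto
    moreover have "(real N + 2) / 4 \<ge> 0" by simp
    ultimately show ?thesis
      using d(2)[of "(real N + 2) / 4"] by linarith
  qed
  \<comment> \<open>The lengths (N + 2)/4 tend to infinity, so the boundary term vanishes in the
    limit and only \<open>2 * b * M\<close> is left.\<close>
  moreover have "(\<lambda>N. 2 * b * M + C * exp (- 2 * b * ((real N + 2) / 4))) \<longlonglongrightarrow> 2 * b * M + C * 0"
  proof (intro tendsto_intros)
    show "(\<lambda>N. exp (- 2 * b * ((real N + 2) / 4))) \<longlonglongrightarrow> 0"
    proof -
      have "exp (- 2 * b * ((real N + 2) / 4)) = exp (- b) * exp (- b / 2) ^ N" for N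
        by (simp flip: exp_of_nat_mult exp_add) (simp add: field_simps)
      moreover have "(\<lambda>N. exp (- b / 2) ^ N) \<longlonglongrightarrow> 0"
        using assms(1) by (intro LIMSEQ_realpow_zero) auto
      ultimately show ?thesis
        by (simp add: tendsto_mult_right_zero)
    qed
  qed
  ultimately have dM: "(\<Sum>k=1..n. (cmod (d k))\<^sup>2) \<le> 2 * b * M"
    by (intro LIMSEQ_le_const[where X = "\<lambda>N. 2 * b * M + C * exp (- 2 * b * ((real N + 2) / 4))"]) auto
  have "cmod (exp_sum n (\<lambda>j. \<i> * lam j * a j) lam 0)
      \<le> (\<Sum>k=1..n. cmod (\<i> * lam k - 2 * b * real (n - k)) * cmod (d k))"
    unfolding d(1) norm_mult[symmetric] by (rule norm_sum)
  then have "(cmod (exp_sum n (\<lambda>j. \<i> * lam j * a j) lam 0))\<^sup>2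
     \<le> (\<Sum>k=1..n. cmod (\<i> * lam k - 2 * b * real (n - k)) * cmod (d k))\<^sup>2"
    by (intro power_mono) auto
  also have "\<dots> \<le> (\<Sum>k=1..n. (cmod (\<i> * lam k - 2 * b * real (n - k)))\<^sup>2) * (\<Sum>k=1..n. (cmod (d k))\<^sup>2)"
    by (rule Cauchy_Schwarz_ineq_sum)
  also have "\<dots> \<le> (\<Sum>k=1..n. (cmod (\<i> * lam k - 2 * b * real (n - k)))\<^sup>2) * (2 * b * M)"
    by (intro mult_left_mono dM sum_nonneg) auto
  also have "(\<Sum>k=1..n. (cmod (\<i> * lam k - 2 * b * real (n - k)))\<^sup>2)
      = (\<Sum>k=1..n. (lam k)\<^sup>2) + (\<Sum>k=1..n. 4 * b\<^sup>2 * (real (n - k))\<^sup>2)"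
    by (simp add: cmod_power2 sum.distrib power_mult_distrib)
  \<comment> \<open>Reversing the order of summation replaces k by n + 1 - k, which turns n - k into
    k - 1.\<close>
  also have "(\<Sum>k=1..n. 4 * b\<^sup>2 * (real (n - k))\<^sup>2) = (\<Sum>k=1..n. 4 * b\<^sup>2 * (real k - 1)\<^sup>2)"
    by (subst sum.atLeastAtMost_rev) (auto intro!: sum.cong simp: of_nat_diff)
  also have "((\<Sum>k=1..n. (lam k)\<^sup>2) + (\<Sum>k=1..n. 4 * b\<^sup>2 * (real k - 1)\<^sup>2)) * (2 * b * M)
    = b ^ 3 * (\<Sum>k=1..n. 2 * (lam k / b)\<^sup>2 + 8 * (real k - 1)\<^sup>2) * M"
    unfolding sum.distrib[symmetric] sum_distrib_left sum_distrib_right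
    using assms(1) by (intro sum.cong) (auto simp: field_simps power2_eq_square power3_eq_cube)
  finally show ?thesis .
qed

subsection \<open>Turan-type recurrences\<close>

definition l1_norm :: "complex poly \<Rightarrow> real" where
  "l1_norm p = (\<Sum>i\<le>degree p. cmod (coeff p i))"

lemma l1_norm_eq: "degree p \<le> N \<Longrightarrow> l1_norm p = (\<Sum>i\<le>N. cmod (coeff p i))"
  unfolding l1_norm_def by (rule sum.mono_neutral_left) (auto simp: coeff_eq_0)

text \<open>The product is p - w X p, and multiplying by w X only shifts the coefficients and
  rotates them by a unimodular factor.\<close>

lemma l1_norm_mult_linear_le:
  assumes "cmod w = 1"
  shows "l1_norm ([:1, - w:] * p) \<le> 2 * l1_norm p"
proof -
  define N where "N = degree p"
  have eq: "[:1, - w:] * p = p - pCons 0 (smult w p)"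
    by (rule poly_eqI) (simp add: coeff_pCons split: nat.split)
  have "degree ([:1, - w:] * p) \<le> Suc N"
    unfolding N_def by (rule order.trans[OF degree_mult_le]) auto
  then have "l1_norm ([:1, - w:] * p) = (\<Sum>i\<le>Suc N. cmod (coeff (p - pCons 0 (smult w p)) i))"
    by (simp only: eq l1_norm_eq)
  also have "\<dots> \<le> (\<Sum>i\<le>Suc N. cmod (coeff p i) + cmod (coeff (pCons 0 (smult w p)) i))"
    by (intro sum_mono) (auto intro: norm_triangle_ineq4)
  also have "\<dots> = (\<Sum>i\<le>Suc N. cmod (coeff p i)) + (\<Sum>i\<le>N. cmod (coeff p i))"
    unfolding sum.distrib by (subst (2) sum.atMost_Suc_shift) (simp add: norm_mult assms)
  also have "\<dots> = 2 * l1_norm p"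
    using l1_norm_eq[of p N] l1_norm_eq[of p "Suc N"] by (simp add: N_def)
  finally show ?thesis .
qed

lemma l1_norm_mult_prod_le:
  assumes "\<And>j. cmod (w j) = 1"
  shows "l1_norm ((\<Prod>j=1..n. [:1, - w j:]) * p) \<le> 2 ^ n * l1_norm p"
proof (induction n)
  case (Suc n)
  have "l1_norm ((\<Prod>j=1..Suc n. [:1, - w j:]) * p) = l1_norm ([:1, - w (Suc n):] * ((\<Prod>j=1..n. [:1, - w j:]) * p))"
    by (subst prod.nat_ivl_Suc') (simp_all only: mult.assoc le_add2 Suc_eq_plus1)
  then show ?case
    using l1_norm_mult_linear_le[OF assms, of "Suc n" "(\<Prod>j=1..n. [:1, - w j:]) * p"] Suc by simp
qed auto

text \<open>Each new factor multiplies \<open>B\<close> by the geometric series of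
  \<open>w (Suc n)\<close>. As its coefficients are unimodular, coefficient l of the product is at
  most the l-th partial sum for \<open>B\<close>, hence at most 2^(n+l). Summing over l up to m
  costs one further factor 2.\<close>

lemma inverse_prod_partial_sums:
  fixes w :: "nat \<Rightarrow> complex"
  assumes "\<And>j. cmod (w j) = 1"
  shows "\<exists>B. fps_of_poly (\<Prod>j=1..n. [:1, - w j:]) * B = 1 \<and> (\<forall>m. (\<Sum>l\<le>m. cmod (B $ l)) \<le> 2 ^ (n + m))"
proof (induction n)
  case 0
  have "(\<Sum>l\<le>m. cmod ((1 :: complex fps) $ l)) \<le> 2 ^ (0 + m)" for m
    by (subst sum.remove[of _ 0]) auto
  then show ?case by (intro exI[of _ 1]) auto
next
  case (Suc n)
  then obtain B where B: "fps_of_poly (\<Prod>j=1..n. [:1, - w j:]) * B = 1"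
    "\<And>m. (\<Sum>l\<le>m. cmod (B $ l)) \<le> 2 ^ (n + m)"
    by blast
  define G where "G = Abs_fps (\<lambda>l. w (Suc n) ^ l)"
  have G: "fps_of_poly [:1, - w (Suc n):] * G = 1"
  proof (rule fps_ext)
    fix l show "(fps_of_poly [:1, - w (Suc n):] * G) $ l = 1 $ l"
      by (cases l) (simp_all add: fps_of_poly_pCons G_def algebra_simps)
  qed
  have "fps_of_poly (\<Prod>j=1..Suc n. [:1, - w j:]) * (B * G)
     = (fps_of_poly (\<Prod>j=1..n. [:1, - w j:]) * B) * (fps_of_poly [:1, - w (Suc n):] * G)"
    by (simp add: fps_of_poly_mult mult_ac del: fps_of_poly_pCons)
  then have 1: "fps_of_poly (\<Prod>j=1..Suc n. [:1, - w j:]) * (B * G) = 1"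
    by (simp only: G B mult_1)
  have 2: "(\<Sum>l\<le>m. cmod ((B * G) $ l)) \<le> 2 ^ (Suc n + m)" for m
  proof -
    have "cmod ((B * G) $ l) \<le> 2 ^ (n + l)" for l
    proof -
      have "cmod ((B * G) $ l) \<le> (\<Sum>i=0..l. cmod (B $ i * G $ (l - i)))"
        unfolding fps_mult_nth by (rule norm_sum)
      also have "\<dots> = (\<Sum>i\<le>l. cmod (B $ i))"
        by (auto simp: norm_mult norm_power G_def assms atLeast0AtMost)
      finally show ?thesis using B(2)[of l] by simp
    qed
    then have "(\<Sum>l\<le>m. cmod ((B * G) $ l)) \<le> (\<Sum>l\<le>m. 2 ^ (n + l))"
      by (intro sum_mono)
    also have "\<dots> = 2 ^ n * (\<Sum>l<Suc m. 2 ^ l)"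
      unfolding lessThan_Suc_atMost by (simp add: power_add sum_distrib_left)
    also have "\<dots> = 2 ^ n * (2 ^ Suc m - 1)"
      by (subst geometric_sum) auto
    also have "\<dots> \<le> 2 ^ (Suc n + m)"
      by (simp add: power_add algebra_simps)
    finally show ?thesis .
  qed
  show ?case using 1 2 by blast
qed

text \<open>Let Q be the product of the 1 - w_j X and B_m the truncation of 1/Q at degree m. Then Q
  B_m is 1 plus terms of degrees m + 1 to m + n, and it vanishes at every 1/w_j. The negated higher
  coefficients are the required \<open>c\<close>; their size is at most 2^n for multiplying by Q
  times 2^(n+m) for B_m.\<close>

lemma turan_coefficients:
  fixes w :: "nat \<Rightarrow> complex"
  assumes w: "\<And>j. cmod (w j) = 1"
  shows "\<exists>c. (\<Sum>k=Suc m..m+n. cmod (c k)) \<le> 2 ^ (2 * n + m) \<and>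
    (\<forall>j\<in>{1..n}. (\<Sum>k=Suc m..m+n. c k * inverse (w j) ^ k) = 1)"
proof -
  define Q where "Q = (\<Prod>j=1..n. [:1, - w j:])"
  obtain B where B: "fps_of_poly Q * B = 1" "\<And>m. (\<Sum>l\<le>m. cmod (B $ l)) \<le> 2 ^ (n + m)"
    using inverse_prod_partial_sums[of w n] w unfolding Q_def by blast
  define Bm where "Bm = (\<Sum>l\<le>m. monom (B $ l) l)"
  have coeff_Bm: "coeff Bm i = (if i \<le> m then B $ i else 0)" for i
    by (auto simp: Bm_def coeff_sum)
  have "degree Bm \<le> m"
    by (rule degree_le) (auto simp: coeff_Bm)
  then have l1Bm: "l1_norm Bm \<le> 2 ^ (n + m)"
    using B(2)[of m] by (simp add: l1_norm_eq coeff_Bm)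
  have "degree Q \<le> n"
  proof -
    have "degree Q \<le> (\<Sum>j=1..n. degree [:1, - w j:])"
      unfolding Q_def using degree_prod_sum_le[of "{1..n}" "\<lambda>j. [:1, - w j:]"] by (simp only: finite_atLeastAtMost comp_def)
    also have "\<dots> \<le> (\<Sum>j=1..n. 1)"
      by (intro sum_mono) auto
    finally show ?thesis by simp
  qed
  then have deg: "degree (Q * Bm) \<le> m + n"
    using degree_mult_le[of Q Bm] \<open>degree Bm \<le> m\<close> by linarith
  \<comment> \<open>Up to degree m the truncation is invisible: the coefficients are those of
    \<open>fps_of_poly Q * B\<close>, which is 1.\<close>
  have low: "coeff (Q * Bm) k = (if k = 0 then 1 else 0)" if "k \<le> m" for k
  proof -
    have "coeff (Q * Bm) k = (\<Sum>i\<le>k. coeff Q i * B $ (k - i))"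
      unfolding coeff_mult using that by (intro sum.cong) (auto simp: coeff_Bm)
    also have "\<dots> = (fps_of_poly Q * B) $ k"
      by (simp add: fps_mult_nth atLeast0AtMost)
    finally show ?thesis by (simp add: B)
  qed
  have split: "(\<Sum>i\<le>m+n. h i) = (\<Sum>i\<le>m. h i) + (\<Sum>i=Suc m..m+n. h i)" for h :: "nat \<Rightarrow> 'b::comm_monoid_add"
    by (subst sum.union_disjoint[symmetric]) (auto intro!: sum.cong)
  have "(\<Sum>k=Suc m..m+n. cmod (- coeff (Q * Bm) k)) \<le> l1_norm (Q * Bm)"
    unfolding l1_norm_eq[OF deg] split by (simp add: sum_nonneg)
  also have "\<dots> \<le> 2 ^ n * l1_norm Bm"
    unfolding Q_def using w by (rule l1_norm_mult_prod_le)
  also have "\<dots> \<le> 2 ^ n * 2 ^ (n + m)"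
    using l1Bm by simp
  also have "\<dots> = 2 ^ (2 * n + m)"
    by (simp flip: power_add add: mult_2 add.assoc)
  finally have 1: "(\<Sum>k=Suc m..m+n. cmod (- coeff (Q * Bm) k)) \<le> 2 ^ (2 * n + m)" .
  have 2: "(\<Sum>k=Suc m..m+n. - coeff (Q * Bm) k * inverse (w j) ^ k) = 1" if j: "j \<in> {1..n}" for j
  proof -
    have wj: "w j \<noteq> 0" using w[of j] by auto
    have "poly Q (inverse (w j)) = 0"
      unfolding Q_def poly_prod using j wj by (auto intro!: bexI[of _ j] simp: prod_zero_iff)
    then have "0 = poly (Q * Bm) (inverse (w j))" by simp
    also have "\<dots> = (\<Sum>i\<le>m+n. coeff (Q * Bm) i * inverse (w j) ^ i)"
      unfolding poly_altdef by (rule sum.mono_neutral_left) (use deg in \<open>auto simp: coeff_eq_0\<close>)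
    also have "\<dots> = (\<Sum>i\<le>m. coeff (Q * Bm) i * inverse (w j) ^ i) + (\<Sum>i=Suc m..m+n. coeff (Q * Bm) i * inverse (w j) ^ i)"
      by (rule split)
    also have "(\<Sum>i\<le>m. coeff (Q * Bm) i * inverse (w j) ^ i) = (\<Sum>i\<le>m. if i = 0 then 1 else 0)"
      by (rule sum.cong) (auto simp: low)
    finally show ?thesis by (simp add: sum_negf add_eq_0_iff)
  qed
  show ?thesis
    using 1 2 by (intro exI[of _ "\<lambda>k. - coeff (Q * Bm) k"]) blast
qed

subsection \<open>Growth of the energy\<close>

definition energy :: "(real \<Rightarrow> complex) \<Rightarrow> real \<Rightarrow> real \<Rightarrow> real" where
  "energy f x y = integral {x..y} (\<lambda>t. (cmod (f t))\<^sup>2)"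

lemma energy_shift: "energy (\<lambda>t. f (t + c)) x y = energy f (x + c) (y + c)"
  using integral_shift_Icc_real[of x y "\<lambda>t. (cmod (f t))\<^sup>2" c]
  by (simp add: energy_def o_def add.commute)

lemma integrable_cmod_exp_sum_sq: "(\<lambda>t. (cmod (exp_sum n a lam t))\<^sup>2) integrable_on {x..y}"
  by (intro integrable_continuous_interval continuous_intros)

lemma energy_nonneg: "energy f x y \<ge> 0"
  \<comment> \<open>The integral of a non-integrable function is 0 by convention, so the bound holds
    for every \<open>f\<close>.\<close>
  unfolding energy_def by (cases "(\<lambda>t. (cmod (f t))\<^sup>2) integrable_on {x..y}")
    (auto intro: integral_nonneg simp: not_integrable_integral)

lemma energy_exp_sum_mono:
  assumes "u \<le> x" "y \<le> v"
  shows "energy (exp_sum n a lam) x y \<le> energy (exp_sum n a lam) u v"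
  unfolding energy_def using assms
  by (intro integral_subset_le integrable_cmod_exp_sum_sq) auto

lemma energy_exp_sum_combine:
  assumes "x \<le> y" "y \<le> z"
  shows "energy (exp_sum n a lam) x z = energy (exp_sum n a lam) x y + energy (exp_sum n a lam) y z"
  unfolding energy_def using assms
  by (intro Henstock_Kurzweil_Integration.integral_combine[symmetric] integrable_cmod_exp_sum_sq) auto

text \<open>Cauchy-Schwarz with |c_k| split into two square roots. Integrating then costs the square
  of the total size of the coefficients, and not the number of terms.\<close>

lemma norm_sum_mult_sq_le:
  fixes c z :: "nat \<Rightarrow> complex"
  shows "(cmod (\<Sum>k\<in>K. c k * z k))\<^sup>2 \<le> (\<Sum>k\<in>K. cmod (c k)) * (\<Sum>k\<in>K. cmod (c k) * (cmod (z k))\<^sup>2)"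
proof -
  have "cmod (\<Sum>k\<in>K. c k * z k) \<le> (\<Sum>k\<in>K. sqrt (cmod (c k)) * (sqrt (cmod (c k)) * cmod (z k)))"
    by (rule order.trans[OF norm_sum]) (simp add: norm_mult flip: mult.assoc)
  then have "(cmod (\<Sum>k\<in>K. c k * z k))\<^sup>2 \<le> (\<Sum>k\<in>K. sqrt (cmod (c k)) * (sqrt (cmod (c k)) * cmod (z k)))\<^sup>2"
    by (intro power_mono) auto
  also have "\<dots> \<le> (\<Sum>k\<in>K. (sqrt (cmod (c k)))\<^sup>2) * (\<Sum>k\<in>K. (sqrt (cmod (c k)) * cmod (z k))\<^sup>2)"
    by (rule Cauchy_Schwarz_ineq_sum)
  finally show ?thesis by (simp add: power_mult_distrib)
qed

lemma exp_sum_turan_extension: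
  assumes "n \<ge> 1"
  shows "energy (exp_sum n a lam) (s + 1/2) (s + 3/4) \<le> 64 ^ n * energy (exp_sum n a lam) s (s + 1/2)"
proof -
  define f where "f = exp_sum n a lam"
  \<comment> \<open>For n < k <= 2n the shift k/(4n) lies between 1/4 and 1/2, so it carries
    [s + 1/2, s + 3/4] into [s, s + 1/2].\<close>
  define \<delta> where "\<delta> = 1 / (4 * real n)"
  define K where "K = {Suc n..n+n}"
  define w where "w j = exp (\<i> * complex_of_real (lam j * \<delta>))" for j
  obtain c where c: "(\<Sum>k\<in>K. cmod (c k)) \<le> 2 ^ (2 * n + n)"
    "\<And>j. j \<in> {1..n} \<Longrightarrow> (\<Sum>k\<in>K. c k * inverse (w j) ^ k) = 1"
    using turan_coefficients[of w n n] unfolding K_def by (auto simp: w_def)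
  have shift: "exp (\<i> * complex_of_real (lam j * (t - k * \<delta>))) = exp (\<i> * complex_of_real (lam j * t)) * inverse (w j) ^ k"
    for j k t unfolding w_def
    by (simp flip: exp_minus exp_of_nat_mult exp_add) (simp add: algebra_simps)
  \<comment> \<open>Translating by k steps back multiplies the j-th exponential by
    \<open>inverse (w j) ^ k\<close>, so the coefficient identity reproduces every term of
    \<open>f\<close>.\<close>
  have rec: "f t = (\<Sum>k\<in>K. c k * f (t - k * \<delta>))" for t
  proof -
    have "(\<Sum>k\<in>K. c k * f (t - k * \<delta>)) = (\<Sum>j=1..n. \<Sum>k\<in>K. a j * exp (\<i> * complex_of_real (lam j * t)) * (c k * inverse (w j) ^ k))"
      unfolding f_def exp_sum_def shift sum_distrib_left
      by (subst sum.swap) (simp add: mult_ac)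
    also have "\<dots> = (\<Sum>j=1..n. a j * exp (\<i> * complex_of_real (lam j * t)))"
      unfolding sum_distrib_left[symmetric] using c(2) by (intro sum.cong) auto
    finally show ?thesis by (simp add: f_def exp_sum_def)
  qed
  define S where "S = (\<Sum>k\<in>K. cmod (c k))"
  have S: "0 \<le> S" "S \<le> 8 ^ n"
  proof -
    show "0 \<le> S" by (simp add: S_def sum_nonneg)
    have "(2 :: real) ^ (2 * n + n) = (2 ^ 3) ^ n"
      by (simp only: power_mult[symmetric]) (simp add: algebra_simps)
    then show "S \<le> 8 ^ n" using c(1) by (simp add: S_def)
  qed
  have cont: "continuous_on X f" for X
    unfolding f_def by (rule continuous_on_exp_sum)
  have cshift: "continuous_on X (\<lambda>t. f (t - k * \<delta>))" for X and k :: nat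
    by (rule continuous_on_compose2[OF cont[of UNIV]]) (auto intro!: continuous_intros)
  have piece: "integral {s+1/2..s+3/4} (\<lambda>t. (cmod (f (t - k * \<delta>)))\<^sup>2) \<le> energy f s (s + 1/2)" if "k \<in> K" for k
  proof -
    have "k * \<delta> \<ge> n * \<delta>" "k * \<delta> \<le> (n + n) * \<delta>"
      using that by (auto intro!: mult_right_mono simp: K_def \<delta>_def)
    then have "k * \<delta> \<ge> 1/4" "k * \<delta> \<le> 1/2"
      using assms by (auto simp: \<delta>_def)
    then show ?thesis
      using energy_shift[of f "- (k * \<delta>)" "s + 1/2" "s + 3/4"]
        energy_exp_sum_mono[of s "s + 1/2 - k * \<delta>" "s + 3/4 - k * \<delta>" "s + 1/2" n a lam]
      by (simp add: energy_def f_def)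
  qed
  have "energy f (s + 1/2) (s + 3/4) \<le>
     integral {s+1/2..s+3/4} (\<lambda>t. S * (\<Sum>k\<in>K. cmod (c k) * (cmod (f (t - k * \<delta>)))\<^sup>2))"
    unfolding energy_def
  proof (intro integral_le integrable_continuous_interval continuous_intros cont cshift)
    fix t show "(cmod (f t))\<^sup>2 \<le> S * (\<Sum>k\<in>K. cmod (c k) * (cmod (f (t - k * \<delta>)))\<^sup>2)"
      using norm_sum_mult_sq_le[of c "\<lambda>k. f (t - k * \<delta>)" K] rec[of t] by (simp add: S_def)
  qed
  also have "\<dots> = S * (\<Sum>k\<in>K. cmod (c k) * integral {s+1/2..s+3/4} (\<lambda>t. (cmod (f (t - k * \<delta>)))\<^sup>2))"
    unfolding integral_mult_right
    by (subst integral_sum)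
      (auto intro!: integrable_continuous_interval continuous_intros cshift simp: K_def)
  also have "\<dots> \<le> S * (\<Sum>k\<in>K. cmod (c k) * energy f s (s + 1/2))"
    using S by (intro mult_left_mono sum_mono piece) auto
  also have "\<dots> = S * S * energy f s (s + 1/2)"
    unfolding S_def by (simp only: sum_distrib_right[symmetric] mult.assoc)
  also have "\<dots> \<le> 8 ^ n * 8 ^ n * energy f s (s + 1/2)"
    using S by (intro mult_right_mono mult_mono energy_nonneg) auto
  also have "8 ^ n * 8 ^ n = (64 ^ n :: real)"
    by (simp flip: power_mult_distrib)
  finally show ?thesis unfolding f_def .
qed

text \<open>Moving the window of length 1/2 by 1/4 stays within the window extended by 1/4, whose
  energy is at most 1 + 64^n <= 65^n times the old one.\<close>

lemma exp_sum_energy_growth: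
  assumes "n \<ge> 1"
  shows "energy (exp_sum n a lam) (real j / 4) (real j / 4 + 1/2) \<le> (65 ^ n) ^ j * energy (exp_sum n a lam) 0 (1/2)"
proof (induction j)
  case (Suc j)
  let ?E = "energy (exp_sum n a lam)"
  have "(64 :: real) ^ n + 1 ^ n \<le> 65 ^ n"
    using assms
  proof (induction n rule: nat_induct_at_least)
    case (Suc n)
    have "(64 :: real) ^ n \<ge> 0" by simp
    with Suc show ?case unfolding power_Suc power_one by linarith
  qed simp
  then have 65: "(1 + 64 ^ n) * ?E (j / 4) (j / 4 + 1/2) \<le> 65 ^ n * ?E (j / 4) (j / 4 + 1/2)"
    by (intro mult_right_mono energy_nonneg) auto
  have "?E (real (Suc j) / 4) (real (Suc j) / 4 + 1/2) \<le> ?E (j / 4) (j / 4 + 3/4)"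
    by (rule energy_exp_sum_mono) (auto simp: add_divide_distrib)
  also have "\<dots> = ?E (j / 4) (j / 4 + 1/2) + ?E (j / 4 + 1/2) (j / 4 + 3/4)"
    by (rule energy_exp_sum_combine) auto
  also have "\<dots> \<le> (1 + 64 ^ n) * ?E (j / 4) (j / 4 + 1/2)"
    using exp_sum_turan_extension[OF assms, of a lam "j / 4"] by (simp add: algebra_simps)
  also note 65
  also have "65 ^ n * ?E (j / 4) (j / 4 + 1/2) \<le> 65 ^ n * ((65 ^ n) ^ j * ?E 0 (1/2))"
    using Suc by (intro mult_left_mono) auto
  finally show ?case by (simp add: mult_ac)
qed simp

section \<open>Weighted energy beyond [0,1/2]\<close>

lemma exp_9_ge: "exp (9::real) \<ge> 7600"
proof -
  have "\<bar>exp 1 - 5837465777 / 2147483648\<bar> \<le> (inverse (2 ^ 32)::real)"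
    by (rule e_approx_32)
  then have "exp (1::real) \<ge> 27 / 10"
    by (simp add: abs_if split: if_splits)
  \<comment> \<open>2.7^9 is about 7625. The bound 7600 is chosen to exceed (260/3)^2, about 7511,
    as used for the ratio \<open>q\<close> below.\<close>
  then have "(27 / 10) ^ 9 \<le> exp (1::real) ^ 9"
    by (intro power_mono) auto
  then show ?thesis
    by (simp add: exp_of_nat_mult[of 9 1, simplified, symmetric] power_divide)
qed

text \<open>The interval is [0,1/2] followed by \<open>N\<close> quarters. The quarter starting at
  j/4 + 1/2 contributes at most \<open>p * q ^ j\<close> times the energy on [0,1/2], so the tail is
  dominated by a geometric series, uniformly in \<open>N\<close>.\<close>

lemma exp_sum_weighted_tail:
  assumes "n \<ge> 1"
  shows "integral {0..(real N + 2) / 4} (\<lambda>t. exp (- 2 * (9 * real n) * t) * (cmod (exp_sum n a lam t))\<^sup>2)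
    \<le> (1 + 8190 * exp (- real n / 10)) * energy (exp_sum n a lam) 0 (1/2)"
proof -
  let ?E = "energy (exp_sum n a lam)"
  let ?I = "\<lambda>x y. integral {x..y} (\<lambda>t. exp (- 2 * (9 * real n) * t) * (cmod (exp_sum n a lam t))\<^sup>2)"
  have int: "(\<lambda>t. exp (- 2 * (9 * real n) * t) * (cmod (exp_sum n a lam t))\<^sup>2) integrable_on {x..y}" for x y
    by (intro integrable_continuous_interval continuous_intros)
  have weight: "?I x y \<le> exp (- 2 * (9 * real n) * x) * ?E x y" for x y
  proof -
    have "?I x y \<le> integral {x..y} (\<lambda>t. exp (- 2 * (9 * real n) * x) * (cmod (exp_sum n a lam t))\<^sup>2)"
    proof (rule integral_le[OF int])
      show "(\<lambda>t. exp (- 2 * (9 * real n) * x) * (cmod (exp_sum n a lam t))\<^sup>2) integrable_on {x..y}"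
        by (intro integrable_continuous_interval continuous_intros)
      fix t assume "t \<in> {x..y}"
      then have "- 2 * (9 * real n) * t \<le> - 2 * (9 * real n) * x"
        by (intro mult_left_mono_neg) auto
      then show "exp (- 2 * (9 * real n) * t) * (cmod (exp_sum n a lam t))\<^sup>2
          \<le> exp (- 2 * (9 * real n) * x) * (cmod (exp_sum n a lam t))\<^sup>2"
        by (intro mult_right_mono) auto
    qed
    then show ?thesis by (simp add: energy_def)
  qed
  \<comment> \<open>\<open>q\<close> is the growth 65^n per quarter step times the decay exp(-9n/2)
    of the weight over it; \<open>p\<close> is the extension factor 64^n times the weight exp(-9n)
    at 1/2.\<close>
  define q where "q = (65 * exp (- 9 / 2 :: real)) ^ n"
  define p where "p = (64 * exp (- 9 :: real)) ^ n"
  have "(exp (9 / 2 :: real))\<^sup>2 = exp 9"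
    unfolding power2_eq_square exp_add[symmetric] by simp
  then have "(260 / 3)\<^sup>2 \<le> (exp (9 / 2 :: real))\<^sup>2"
    using exp_9_ge by (simp add: power2_eq_square)
  \<comment> \<open>260/3 is the value for which 65 / (260/3) = 3/4.\<close>
  then have "exp (9 / 2 :: real) \<ge> 260 / 3"
    by (rule power2_le_imp_le) auto
  have "65 * exp (- 9 / 2 :: real) \<le> 3 / 4"
  proof -
    have "exp (- 9 / 2 :: real) = inverse (exp (9 / 2))"
      using exp_minus[of "9 / 2 :: real"] by (simp only: minus_divide_left)
    also have "\<dots> \<le> inverse (260 / 3)"
      using \<open>exp (9 / 2 :: real) \<ge> 260 / 3\<close> by (intro le_imp_inverse_le) auto
    finally show ?thesis by simp
  qed
  moreover from this have "(65 * exp (- 9 / 2 :: real)) ^ n \<le> (65 * exp (- 9 / 2)) ^ 1"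
    using assms by (intro power_decreasing) auto
  ultimately have q: "0 \<le> q" "q \<le> 3 / 4"
    unfolding q_def by auto
  have "p \<ge> 0" by (simp add: p_def)
  have main: "?I 0 ((real N + 2) / 4) \<le> (1 + p * (\<Sum>j<N. q ^ j)) * ?E 0 (1/2)" for N
  proof (induction N)
    case 0
    then show ?case using weight[of 0 "1/2"] by simp
  next
    case (Suc N)
    have ends: "(real N + 2) / 4 = real N / 4 + 1/2" "(real (Suc N) + 2) / 4 = real N / 4 + 3/4"
      by (simp_all add: add_divide_distrib)
    have "?I ((real N + 2) / 4) ((real (Suc N) + 2) / 4)
        \<le> exp (- 2 * (9 * real n) * ((real N + 2) / 4)) * ?E (real N / 4 + 1/2) (real N / 4 + 3/4)"
      using weight[of "(real N + 2) / 4" "(real (Suc N) + 2) / 4"] by (simp only: ends)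
    also have "\<dots> \<le> exp (- 2 * (9 * real n) * ((real N + 2) / 4)) * (64 ^ n * ((65 ^ n) ^ N * ?E 0 (1/2)))"
      by (intro mult_left_mono order.trans[OF exp_sum_turan_extension[OF assms]] exp_sum_energy_growth assms) auto
    also have "exp (- 2 * (9 * real n) * ((real N + 2) / 4)) = exp (- 9) ^ n * (exp (- 9 / 2) ^ n) ^ N"
    proof -
      have "- 2 * (9 * real n) * ((real N + 2) / 4) = real n * (- 9) + real N * (real n * (- 9 / 2))"
        by (simp add: field_simps)
      then show ?thesis by (simp only: exp_add exp_of_nat_mult)
    qed
    also have "exp (- 9) ^ n * (exp (- 9 / 2) ^ n) ^ N * (64 ^ n * ((65 ^ n) ^ N * ?E 0 (1/2))) = p * q ^ N * ?E 0 (1/2)"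
      by (simp add: p_def q_def power_mult_distrib mult_ac)
    finally have "?I ((real N + 2) / 4) ((real (Suc N) + 2) / 4) \<le> p * q ^ N * ?E 0 (1/2)" .
    moreover have "?I 0 ((real (Suc N) + 2) / 4) = ?I 0 ((real N + 2) / 4) + ?I ((real N + 2) / 4) ((real (Suc N) + 2) / 4)"
      by (rule Henstock_Kurzweil_Integration.integral_combine[symmetric, OF _ _ int]) auto
    moreover have "(1 + p * (\<Sum>j<Suc N. q ^ j)) * ?E 0 (1/2) = (1 + p * (\<Sum>j<N. q ^ j)) * ?E 0 (1/2) + p * q ^ N * ?E 0 (1/2)"
      by (simp add: algebra_simps)
    ultimately show ?case using Suc by linarith
  qed
  have "(1 - q) * (\<Sum>j<N. q ^ j) \<le> 1"
    unfolding one_diff_power_eq[symmetric] using q by simp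
  moreover have "1/4 * (\<Sum>j<N. q ^ j) \<le> (1 - q) * (\<Sum>j<N. q ^ j)"
    using q by (intro mult_right_mono sum_nonneg) auto
  ultimately have "(\<Sum>j<N. q ^ j) \<le> 4" by simp
  then have "p * (\<Sum>j<N. q ^ j) \<le> p * 4"
    using \<open>p \<ge> 0\<close> by (intro mult_left_mono)
  also have "p \<le> exp (- 1 / 10) ^ n"
    unfolding p_def
  proof (intro power_mono)
    \<comment> \<open>exp(-1/10) is at least 1 - 1/10, and nine tenths of exp 9 is far above
      64.\<close>
    have "64 \<le> exp (9::real) * (1 + - 1 / 10)" using exp_9_ge by simp
    also have "\<dots> \<le> exp 9 * exp (- 1 / 10)"
      by (intro mult_left_mono exp_ge_add_one_self) auto
    finally have "exp (- 9) * 64 \<le> exp (- 9) * (exp 9 * exp (- 1 / 10 :: real))"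
      by (intro mult_left_mono) auto
    also have "\<dots> = exp (- 1 / 10 :: real)"
      unfolding exp_add[symmetric] by simp
    finally show "64 * exp (- 9) \<le> exp (- 1 / 10 :: real)"
      by (simp only: mult.commute)
  qed auto
  also have "exp (- 1 / 10) ^ n = exp (- real n / 10)"
    by (simp only: exp_of_nat_mult[symmetric]) simp
  \<comment> \<open>The series contributes at most 4 exp(-n/10), well within the stated 8190
    exp(-n/10).\<close>
  finally have "p * (\<Sum>j<N. q ^ j) \<le> 8190 * exp (- real n / 10)"
    using exp_gt_zero[of "- real n / 10"] by linarith
  then have "(1 + p * (\<Sum>j<N. q ^ j)) * ?E 0 (1/2) \<le> (1 + 8190 * exp (- real n / 10)) * ?E 0 (1/2)"
    by (intro mult_right_mono energy_nonneg) auto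
  with main[of N] show ?thesis by linarith
qed

section \<open>From the estimate at 0 to the whole interval\<close>

lemma exp_sum_deriv_0_energy:
  assumes "n \<ge> 1"
  shows "(cmod (exp_sum n (\<lambda>j. \<i> * lam j * a j) lam 0))\<^sup>2 \<le>
    (27 * (1 + eps_n n) * real n powr (3/2)
       * sqrt (\<Sum>k=1..n. 2 * (lam k / (9 * real n))\<^sup>2 + 8 * (real k - 1)\<^sup>2))\<^sup>2
     * energy (exp_sum n a lam) 0 (1/2)"
proof -
  have n: "(real n powr (3/2))\<^sup>2 = real n ^ 3"
    using assms by (simp add: powr_power powr_numeral)
  have e: "(1 + eps_n n)\<^sup>2 = 1 + 8190 * exp (- real n / 10)"
    unfolding eps_n_def by (simp add: add_nonneg_nonneg)
  have s: "(sqrt (\<Sum>k=1..n. 2 * (lam k / (9 * real n))\<^sup>2 + 8 * (real k - 1)\<^sup>2))\<^sup>2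
     = (\<Sum>k=1..n. 2 * (lam k / (9 * real n))\<^sup>2 + 8 * (real k - 1)\<^sup>2)"
    by (intro real_sqrt_pow2 sum_nonneg) auto
  \<comment> \<open>With b = 9n the factor b^3 is 27^2 n^3, which is where 27 and n^(3/2) come from.
    \<open>Y\<close> stands for the square of 1 + \<open>eps_n n\<close>.\<close>
  have eq: "9 ^ 3 * real n ^ 3 * S * (Y * E) = 27\<^sup>2 * Y * real n ^ 3 * S * E" for S Y E :: real
    by simp
  have "9 * real n > 0" using assms by simp
  from exp_sum_deriv_0_bound[OF this exp_sum_weighted_tail[OF assms], of lam a]
  show ?thesis
    unfolding power_mult_distrib n e s eq .
qed

theorem theorem5p2:
  fixes n :: nat and a :: "nat \<Rightarrow> complex" and lam :: "nat \<Rightarrow> real"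
  assumes "n \<ge> 1"
    and "\<And>j k. 1 \<le> j \<Longrightarrow> j < k \<Longrightarrow> k \<le> n \<Longrightarrow> lam j < lam k"
  shows "sup_norm01 (\<lambda>t. vector_derivative (exp_sum n a lam) (at t))
    \<le> 27 * (1 + eps_n n) * real n powr (3/2)
       * sqrt (\<Sum>k=1..n. 2 * (lam k / (9 * real n))\<^sup>2 + 8 * (real k - 1)\<^sup>2)
       * L2_norm01 (exp_sum n a lam)"
proof -
  define C where "C = 27 * (1 + eps_n n) * real n powr (3/2)
       * sqrt (\<Sum>k=1..n. 2 * (lam k / (9 * real n))\<^sup>2 + 8 * (real k - 1)\<^sup>2)"
  have "C \<ge> 0"
    unfolding C_def eps_n_def by (intro mult_nonneg_nonneg real_sqrt_ge_zero sum_nonneg) auto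
  have L2: "(L2_norm01 (exp_sum n a lam))\<^sup>2 = energy (exp_sum n a lam) 0 1"
    using energy_nonneg[of "exp_sum n a lam" 0 1] by (simp add: L2_norm01_def energy_def)
  have "cmod (vector_derivative (exp_sum n a lam) (at t)) \<le> C * L2_norm01 (exp_sum n a lam)"
    if t: "t \<in> {0..1}" for t
  proof (rule power2_le_imp_le)
    \<comment> \<open>Translation by \<open>t\<close> is absorbed into the coefficients, so that the
      derivative at \<open>t\<close> becomes one at 0.\<close>
    define a' where "a' j = a j * exp (\<i> * complex_of_real (lam j * t))" for j
    have vd: "vector_derivative (exp_sum n a lam) (at t) = exp_sum n (\<lambda>j. \<i> * lam j * a' j) lam 0"
      unfolding vector_derivative_at[OF exp_sum_has_vector_derivative]
      by (simp add: exp_sum_def a'_def mult_ac)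
    \<comment> \<open>Reflection negates the frequencies and the derivative at 0, leaving its
      modulus unchanged.\<close>
    have vd': "cmod (vector_derivative (exp_sum n a lam) (at t)) = cmod (exp_sum n (\<lambda>j. \<i> * complex_of_real (- lam j) * a' j) (\<lambda>j. - lam j) 0)"
      unfolding vd by (simp add: exp_sum_def sum_negf)
    have f: "exp_sum n a' lam = (\<lambda>s. exp_sum n a lam (s + t))"
      by (auto simp: exp_sum_def a'_def fun_eq_iff algebra_simps exp_add)
    have f': "exp_sum n a' (\<lambda>j. - lam j) = (\<lambda>s. exp_sum n a' lam (- s))"
      by (auto simp: exp_sum_def fun_eq_iff)
    have "(cmod (vector_derivative (exp_sum n a lam) (at t)))\<^sup>2 \<le> C\<^sup>2 * energy (exp_sum n a lam) 0 1"
    proof (cases "t \<le> 1/2")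
      case True
      then have "energy (exp_sum n a' lam) 0 (1/2) \<le> energy (exp_sum n a lam) 0 1"
        unfolding f energy_shift using t by (intro energy_exp_sum_mono) auto
      then have "C\<^sup>2 * energy (exp_sum n a' lam) 0 (1/2) \<le> C\<^sup>2 * energy (exp_sum n a lam) 0 1"
        by (intro mult_left_mono) auto
      then show ?thesis
        using exp_sum_deriv_0_energy[OF assms(1), of lam a'] unfolding vd C_def by linarith
    next
      case False
      \<comment> \<open>For t > 1/2 the reflected sum on [0,1/2] sees the original one on
        [t - 1/2, t], which lies in [0,1]. \<open>C\<close> contains the frequencies only through
        their squares, so it is the same for \<open>- lam\<close>.\<close>
      have "energy (exp_sum n a' (\<lambda>j. - lam j)) 0 (1/2) = energy (exp_sum n a' lam) (- 1/2) 0"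
        unfolding f' energy_def
        using Henstock_Kurzweil_Integration.integral_reflect_real[of 0 "- 1/2" "\<lambda>t. (cmod (exp_sum n a' lam t))\<^sup>2"] by simp
      also have "\<dots> \<le> energy (exp_sum n a lam) 0 1"
        unfolding f energy_shift using t False by (intro energy_exp_sum_mono) auto
      finally have "C\<^sup>2 * energy (exp_sum n a' (\<lambda>j. - lam j)) 0 (1/2) \<le> C\<^sup>2 * energy (exp_sum n a lam) 0 1"
        by (intro mult_left_mono) auto
      then show ?thesis
        using exp_sum_deriv_0_energy[OF assms(1), of "\<lambda>j. - lam j" a'] unfolding vd' C_def
        by (simp add: power2_eq_square)
    qed
    then show "(cmod (vector_derivative (exp_sum n a lam) (at t)))\<^sup>2 \<le> (C * L2_norm01 (exp_sum n a lam))\<^sup>2"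
      by (simp add: power_mult_distrib L2)
    show "0 \<le> C * L2_norm01 (exp_sum n a lam)"
      using \<open>C \<ge> 0\<close> energy_nonneg[of "exp_sum n a lam" 0 1] by (simp add: L2_norm01_def energy_def)
  qed
  then show ?thesis
    unfolding sup_norm01_def C_def by (intro cSUP_least) auto
qed

end
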